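(* Let $T$ be a non-empty set and let $X\subseteq\mathbb{R}^T$ be a reproducing kernel Banach space. A symmetric positive operator $R:X^*\to X$ is uniquely determined by its kernel: if $R_1,R_2:X^*\to X$ are symmetric positive operators and $\langle R_1\delta_s,\delta_t\rangle=\langle R_2\delta_s,\delta_t\rangle$ for all $s,t\in T$, then $R_1=R_2$.
   Context: All vector spaces are real. A Banach space $X$ that is a linear subspace of $\mathbb{R}^T$ (real functions on $T$) is a reproducing kernel Banach space if for every $t\in T$ the evaluation functional $\delta_t : X \to \mathbb{R}$, $x \mapsto x(t)$, is continuous. We write $\langle x,f\rangle=f(x)$ for $x\in X$, $f\in X^*$. A map $R:X^*\to X$ is symmetric if $\langle Rf,g\rangle=\langle Rg,f\rangle$ for all $f,g\in X^*$, and positive if $\langle Rf,f\rangle\ge 0$ for all $f\in X^*$ (a symmetric positive operator is automatically linear and continuous). The kernel of a symmetric positive operator $R$ is the function $K:T\times T\to\mathbb{R}$, $K(s,t)=\langle R\delta_s,\delta_t\rangle$. *)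

theory Defs
  imports "HOL-Analysis.Analysis"
begin

text \<open>
  Functions and operators on a carrier set follow the conventions of \<open>FuncSet\<close>: \<open>\<real>\<^sup>T\<close> is
  \<open>T \<rightarrow>\<^sub>E UNIV\<close>, and linear functionals on \<open>X\<close> are extensional outside \<open>X\<close>, so that equality
  in HOL is equality of maps on the carrier.
\<close>

definition fun_zero :: "'t set \<Rightarrow> 't \<Rightarrow> real" where
  "fun_zero T = (\<lambda>t\<in>T. 0)"

definition fun_add :: "'t set \<Rightarrow> ('t \<Rightarrow> real) \<Rightarrow> ('t \<Rightarrow> real) \<Rightarrow> 't \<Rightarrow> real" where
  "fun_add T x y = (\<lambda>t\<in>T. x t + y t)"

definition fun_diff :: "'t set \<Rightarrow> ('t \<Rightarrow> real) \<Rightarrow> ('t \<Rightarrow> real) \<Rightarrow> 't \<Rightarrow> real" where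
  "fun_diff T x y = (\<lambda>t\<in>T. x t - y t)"

definition fun_scale :: "'t set \<Rightarrow> real \<Rightarrow> ('t \<Rightarrow> real) \<Rightarrow> 't \<Rightarrow> real" where
  "fun_scale T c x = (\<lambda>t\<in>T. c * x t)"

locale normed_function_space =
  fixes T :: "'t set" and X :: "('t \<Rightarrow> real) set" and N :: "('t \<Rightarrow> real) \<Rightarrow> real"
  assumes subset: "X \<subseteq> T \<rightarrow>\<^sub>E UNIV"
    and zero_mem: "fun_zero T \<in> X"
    and add_mem: "\<And>x y. x \<in> X \<Longrightarrow> y \<in> X \<Longrightarrow> fun_add T x y \<in> X"
    and scale_mem: "\<And>c x. x \<in> X \<Longrightarrow> fun_scale T c x \<in> X"
    and norm_nonneg: "\<And>x. x \<in> X \<Longrightarrow> 0 \<le> N x"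
    and norm_eq_zero: "\<And>x. x \<in> X \<Longrightarrow> N x = 0 \<longleftrightarrow> x = fun_zero T"
    and norm_scale: "\<And>c x. x \<in> X \<Longrightarrow> N (fun_scale T c x) = \<bar>c\<bar> * N x"
    and norm_triangle: "\<And>x y. x \<in> X \<Longrightarrow> y \<in> X \<Longrightarrow> N (fun_add T x y) \<le> N x + N y"

text \<open>
  The value \<open>0\<close> off \<open>X\<close> is irrelevant; it is there because \<^locale>\<open>Metric_space\<close> asks for
  nonnegativity and symmetry of the distance on the whole type.
\<close>

definition norm_dist ::
  "'t set \<Rightarrow> ('t \<Rightarrow> real) set \<Rightarrow> (('t \<Rightarrow> real) \<Rightarrow> real) \<Rightarrow> ('t \<Rightarrow> real) \<Rightarrow> ('t \<Rightarrow> real) \<Rightarrow> real" where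
  "norm_dist T X N x y = (if x \<in> X \<and> y \<in> X then N (fun_diff T x y) else 0)"

abbreviation norm_topology ::
  "'t set \<Rightarrow> ('t \<Rightarrow> real) set \<Rightarrow> (('t \<Rightarrow> real) \<Rightarrow> real) \<Rightarrow> ('t \<Rightarrow> real) topology" where
  "norm_topology T X N \<equiv> Metric_space.mtopology X (norm_dist T X N)"

lemma (in normed_function_space) Metric_space_norm_dist:
  "Metric_space X (norm_dist T X N)"
proof
  have diff_eq: "fun_diff T x y = fun_add T x (fun_scale T (-1) y)" for x y
    by (auto simp: fun_diff_def fun_add_def fun_scale_def)
  have diff_mem: "fun_diff T x y \<in> X" if "x \<in> X" "y \<in> X" for x y
    using that by (simp add: diff_eq add_mem scale_mem)
  show "0 \<le> norm_dist T X N x y" for x y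
    by (simp add: norm_dist_def norm_nonneg diff_mem)
  show "norm_dist T X N x y = norm_dist T X N y x" for x y
  proof (cases "x \<in> X \<and> y \<in> X")
    case True
    have "fun_diff T x y = fun_scale T (-1) (fun_diff T y x)"
      by (auto simp: fun_diff_def fun_scale_def)
    then show ?thesis
      using True by (simp add: norm_dist_def norm_scale diff_mem)
  qed (auto simp: norm_dist_def)
  show "norm_dist T X N x y = 0 \<longleftrightarrow> x = y" if "x \<in> X" "y \<in> X" for x y
  proof -
    have xy: "x \<in> T \<rightarrow>\<^sub>E UNIV" "y \<in> T \<rightarrow>\<^sub>E UNIV"
      using subset that by auto
    have "fun_diff T x y = fun_zero T \<longleftrightarrow> (\<forall>t\<in>T. x t = y t)"
      by (auto simp: fun_diff_def fun_zero_def fun_eq_iff restrict_def)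
    also have "\<dots> \<longleftrightarrow> x = y"
      using PiE_ext[OF xy] by auto
    finally show ?thesis
      using that by (simp add: norm_dist_def norm_eq_zero diff_mem)
  qed
  show "norm_dist T X N x z \<le> norm_dist T X N x y + norm_dist T X N y z"
    if "x \<in> X" "y \<in> X" "z \<in> X" for x y z
  proof -
    have "fun_diff T x z = fun_add T (fun_diff T x y) (fun_diff T y z)"
      by (auto simp: fun_diff_def fun_add_def)
    then show ?thesis
      using that by (simp add: norm_dist_def norm_triangle diff_mem)
  qed
qed

locale banach_function_space = normed_function_space +
  assumes complete: "Metric_space.mcomplete X (norm_dist T X N)"

definition point_eval :: "('t \<Rightarrow> real) set \<Rightarrow> 't \<Rightarrow> ('t \<Rightarrow> real) \<Rightarrow> real" where
  "point_eval X t = (\<lambda>x\<in>X. x t)"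

locale rkbs = banach_function_space +
  assumes continuous_point_eval:
    "\<And>t. t \<in> T \<Longrightarrow> continuous_map (norm_topology T X N) euclideanreal (point_eval X t)"

definition dual_space ::
  "'t set \<Rightarrow> ('t \<Rightarrow> real) set \<Rightarrow> (('t \<Rightarrow> real) \<Rightarrow> real) \<Rightarrow> (('t \<Rightarrow> real) \<Rightarrow> real) set" where
  "dual_space T X N = {f \<in> X \<rightarrow>\<^sub>E UNIV.
     (\<forall>x\<in>X. \<forall>y\<in>X. f (fun_add T x y) = f x + f y) \<and>
     (\<forall>c. \<forall>x\<in>X. f (fun_scale T c x) = c * f x) \<and>
     continuous_map (norm_topology T X N) euclideanreal f}"

text \<open>The pairing \<open>\<langle>x, f\<rangle>\<close> of \<open>x \<in> X\<close> with a functional \<open>f\<close> is the application \<open>f x\<close>.\<close>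

definition symmetric_operator ::
  "'t set \<Rightarrow> ('t \<Rightarrow> real) set \<Rightarrow> (('t \<Rightarrow> real) \<Rightarrow> real) \<Rightarrow>
     ((('t \<Rightarrow> real) \<Rightarrow> real) \<Rightarrow> 't \<Rightarrow> real) \<Rightarrow> bool" where
  "symmetric_operator T X N R \<longleftrightarrow>
     (\<forall>f\<in>dual_space T X N. \<forall>g\<in>dual_space T X N. g (R f) = f (R g))"

definition positive_operator ::
  "'t set \<Rightarrow> ('t \<Rightarrow> real) set \<Rightarrow> (('t \<Rightarrow> real) \<Rightarrow> real) \<Rightarrow>
     ((('t \<Rightarrow> real) \<Rightarrow> real) \<Rightarrow> 't \<Rightarrow> real) \<Rightarrow> bool" where
  "positive_operator T X N R \<longleftrightarrow> (\<forall>f\<in>dual_space T X N. 0 \<le> f (R f))"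

definition operator_kernel ::
  "('t \<Rightarrow> real) set \<Rightarrow> ((('t \<Rightarrow> real) \<Rightarrow> real) \<Rightarrow> 't \<Rightarrow> real) \<Rightarrow> 't \<Rightarrow> 't \<Rightarrow> real" where
  "operator_kernel X R s t = point_eval X t (R (point_eval X s))"

end

theory Submission
  imports Defs
begin

text \<open>
  By symmetry \<open>(R f)(t) = f (R \<delta>\<^sub>t)\<close>, so \<open>R\<close> is determined by its values on the point
  evaluations, and the kernel is nothing but these values: \<open>(R \<delta>\<^sub>s)(t) = K(s,t)\<close>.
\<close>

text \<open>Continuity is the defining property of an RKBS. Linearity holds since the operations are
  pointwise on \<open>T\<close> and \<open>X\<close> is closed under them, so the restriction to
  \<open>X\<close> in \<open>point_eval\<close> does no harm.\<close>

lemma (in rkbs) point_eval_mem_dual_space: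
  assumes "t \<in> T"
  shows "point_eval X t \<in> dual_space T X N"
  using assms add_mem scale_mem continuous_point_eval
  by (auto simp: dual_space_def point_eval_def fun_add_def fun_scale_def)

text \<open>Elements of \<open>X\<close> are extensional, hence all \<open>undefined\<close> off
  \<open>T\<close>.\<close>

lemma (in rkbs) ext_on_index_set:
  assumes "x \<in> X" "y \<in> X" "\<And>t. t \<in> T \<Longrightarrow> x t = y t"
  shows "x = y"
  using PiE_ext[of x T "\<lambda>_. UNIV" y] subset assms by blast

lemma (in rkbs) symmetric_operator_apply:
  assumes "R \<in> dual_space T X N \<rightarrow>\<^sub>E X" "symmetric_operator T X N R"
    and "f \<in> dual_space T X N" "t \<in> T"
  shows "R f t = f (R (point_eval X t))"
proof -
  have "R f \<in> X"
    using assms by auto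
  then have "R f t = point_eval X t (R f)"
    by (simp add: point_eval_def)
  \<comment> \<open>Symmetry for the pair \<open>f\<close> and
    \<open>g = point_eval X t\<close>.\<close>
  also have "\<dots> = f (R (point_eval X t))"
    using assms point_eval_mem_dual_space unfolding symmetric_operator_def by blast
  finally show ?thesis .
qed

theorem mainTheorem4:
  fixes T :: "'t set" and X :: "('t \<Rightarrow> real) set" and N :: "('t \<Rightarrow> real) \<Rightarrow> real"
    and R1 R2 :: "(('t \<Rightarrow> real) \<Rightarrow> real) \<Rightarrow> 't \<Rightarrow> real"
  assumes "T \<noteq> {}"
    and "rkbs T X N"
    and "R1 \<in> dual_space T X N \<rightarrow>\<^sub>E X"
    and "symmetric_operator T X N R1"
    and "positive_operator T X N R1"
    and "R2 \<in> dual_space T X N \<rightarrow>\<^sub>E X"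
    and "symmetric_operator T X N R2"
    and "positive_operator T X N R2"
    and "\<And>s t. s \<in> T \<Longrightarrow> t \<in> T \<Longrightarrow> operator_kernel X R1 s t = operator_kernel X R2 s t"
  shows "R1 = R2"
proof (rule PiE_ext)
  interpret rkbs T X N by fact
  show "R1 \<in> dual_space T X N \<rightarrow>\<^sub>E X" "R2 \<in> dual_space T X N \<rightarrow>\<^sub>E X"
    by fact+
  then have mem: "R1 f \<in> X" "R2 f \<in> X" if "f \<in> dual_space T X N" for f
    using that by auto
  have eq_point_eval: "R1 (point_eval X s) = R2 (point_eval X s)" if "s \<in> T" for s
  proof (rule ext_on_index_set)
    show "R1 (point_eval X s) \<in> X" "R2 (point_eval X s) \<in> X"
      using mem point_eval_mem_dual_space that by auto
    \<comment> \<open>Membership in \<open>X\<close> lets the outer \<open>point_eval X t\<close> in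
      the kernel unfold to the value at \<open>t\<close>.\<close>
    then show "R1 (point_eval X s) t = R2 (point_eval X s) t" if "t \<in> T" for t
      using assms(9)[OF \<open>s \<in> T\<close> that] by (simp add: operator_kernel_def point_eval_def)
  qed
  show "R1 f = R2 f" if f: "f \<in> dual_space T X N" for f
  proof (rule ext_on_index_set)
    show "R1 f \<in> X" "R2 f \<in> X"
      using mem f by auto
    show "R1 f t = R2 f t" if "t \<in> T" for t
      \<comment> \<open>Both values are \<open>f\<close> applied to the same element of
        \<open>X\<close>.\<close>
      using symmetric_operator_apply[OF assms(3,4) f that]
        symmetric_operator_apply[OF assms(6,7) f that] eq_point_eval[OF that] by simp
  qed
qed

end
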